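(* Let $R$ be a $\mathbb{Z}^n$-graded ring of characteristic $p>0$, $I$ a homogeneous ideal of $R$, and $s\geq 1$ a real number. Then $I^{\{s\}}$ and $I^{\mathrm{cl}_s}$ are homogeneous ideals. Furthermore, if $R$ is a domain and $x\in I^{\{s\}}$, then there exists a nonzero homogeneous element $c\in R$ such that $cx^q\in I^{(s,q)}$ for all $q\gg 0$.
   Context: All rings are commutative and noetherian. $R^\circ$ denotes the set of elements of $R$ lying in no minimal prime of $R$. The letter $q$ denotes positive integer powers of $p$, and $q\gg 0$ means all sufficiently large such powers. $I^{[q]}=(f^q\mid f\in I)$ is the $q$th Frobenius power of $I$. For a real number $s\geq 1$, $I^{(s,q)}=I^{\lceil sq\rceil}+I^{[q]}$. The weak $s$-closure $I^{\{s\}}$ is the ideal of all $x\in R$ for which there exists $c\in R^\circ$ such that $cx^q\in I^{(s,q)}$ for all $q\gg 0$. The $s$-closure $I^{\mathrm{cl}_s}$ is the ideal at which the increasing chain $I\subseteq I^{\{s\}}\subseteq (I^{\{s\}})^{\{s\}}\subseteq\cdots$ stabilizes. *)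

theory Defs
  imports Complex_Main "HOL-Algebra.Algebra"
begin

abbreviation Zn :: "nat \<Rightarrow> (nat \<Rightarrow> int) monoid"
  where "Zn n \<equiv> product_group {..<n} (\<lambda>_. integer_group)"

locale Zn_graded_ring = cring R for n :: nat and R :: "('a, 'b) ring_scheme" (structure) and A :: "(nat \<Rightarrow> int) \<Rightarrow> 'a set" +
  assumes component_subgroup: "d \<in> carrier (Zn n) \<Longrightarrow> additive_subgroup (A d) R"
    and direct_sum: "x \<in> carrier R \<Longrightarrow>
      \<exists>!f. f \<in> (\<Pi>\<^sub>E d\<in>carrier (Zn n). A d) \<and>
           finite {d \<in> carrier (Zn n). f d \<noteq> \<zero>} \<and>
           x = (\<Oplus>d\<in>{d \<in> carrier (Zn n). f d \<noteq> \<zero>}. f d)"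
    and mult_degree: "\<lbrakk>d \<in> carrier (Zn n); e \<in> carrier (Zn n); x \<in> A d; y \<in> A e\<rbrakk>
      \<Longrightarrow> x \<otimes> y \<in> A (d \<otimes>\<^bsub>Zn n\<^esub> e)"

text \<open>Zero is homogeneous (of every degree).\<close>

definition homogeneous_elem :: "nat \<Rightarrow> ((nat \<Rightarrow> int) \<Rightarrow> 'a set) \<Rightarrow> 'a \<Rightarrow> bool"
  where "homogeneous_elem n A x \<longleftrightarrow> (\<exists>d\<in>carrier (Zn n). x \<in> A d)"

definition homogeneous_ideal ::
    "nat \<Rightarrow> ('a, 'b) ring_scheme \<Rightarrow> ((nat \<Rightarrow> int) \<Rightarrow> 'a set) \<Rightarrow> 'a set \<Rightarrow> bool"
  where "homogeneous_ideal n R A I \<longleftrightarrow>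
    ideal I R \<and> (\<exists>S. (\<forall>x\<in>S. homogeneous_elem n A x) \<and> I = genideal R S)"

definition has_characteristic :: "('a, 'b) ring_scheme \<Rightarrow> nat \<Rightarrow> bool"
  where "has_characteristic R p \<longleftrightarrow> (\<forall>k::nat. [k] \<cdot>\<^bsub>R\<^esub> \<one>\<^bsub>R\<^esub> = \<zero>\<^bsub>R\<^esub> \<longleftrightarrow> p dvd k)"

definition minimal_prime :: "('a, 'b) ring_scheme \<Rightarrow> 'a set \<Rightarrow> bool"
  where "minimal_prime R P \<longleftrightarrow>
    primeideal P R \<and> (\<forall>Q. primeideal Q R \<and> Q \<subseteq> P \<longrightarrow> Q = P)"

definition R_circ :: "('a, 'b) ring_scheme \<Rightarrow> 'a set"
  where "R_circ R = {c \<in> carrier R. \<forall>P. minimal_prime R P \<longrightarrow> c \<notin> P}"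

definition frobenius_power :: "('a, 'b) ring_scheme \<Rightarrow> 'a set \<Rightarrow> nat \<Rightarrow> 'a set"
  where "frobenius_power R I q = genideal R {f [^]\<^bsub>R\<^esub> q | f. f \<in> I}"

text \<open>The ordinary power of an ideal is the power in the semiring of ideals
  \<^term>\<open>ideals_set R\<close>, whose multiplication is the ideal product.\<close>

definition sq_power :: "('a, 'b) ring_scheme \<Rightarrow> real \<Rightarrow> 'a set \<Rightarrow> nat \<Rightarrow> 'a set"
  where "sq_power R s I q =
    (I [^]\<^bsub>ideals_set R\<^esub> nat \<lceil>s * real q\<rceil>) <+>\<^bsub>R\<^esub> frobenius_power R I q"

definition for_large_q :: "nat \<Rightarrow> (nat \<Rightarrow> bool) \<Rightarrow> bool"
  where "for_large_q p P \<longleftrightarrow> (\<exists>q\<^sub>0. \<forall>q\<in>{p ^ e | e. e \<ge> 1}. q \<ge> q\<^sub>0 \<longrightarrow> P q)"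

definition weak_s_closure :: "('a, 'b) ring_scheme \<Rightarrow> nat \<Rightarrow> real \<Rightarrow> 'a set \<Rightarrow> 'a set"
  where "weak_s_closure R p s I =
    {x \<in> carrier R. \<exists>c\<in>R_circ R.
       for_large_q p (\<lambda>q. c \<otimes>\<^bsub>R\<^esub> (x [^]\<^bsub>R\<^esub> q) \<in> sq_power R s I q)}"

text \<open>The eventual value of the chain of iterated weak closures. The description is
  meaningful when the chain stabilizes, as it does for an ideal of a noetherian ring of
  prime characteristic.\<close>

definition s_closure :: "('a, 'b) ring_scheme \<Rightarrow> nat \<Rightarrow> real \<Rightarrow> 'a set \<Rightarrow> 'a set"
  where "s_closure R p s I = (THE J. \<exists>N. \<forall>k\<ge>N. (weak_s_closure R p s ^^ k) I = J)"

end

theory Submission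
  imports Defs
begin

text \<open>Everything rests on one observation about degrees. Let \<open>x = \<Sum>x\<^sub>d\<close> and \<open>c = \<Sum>c\<^sub>e\<close> be
  the decompositions into homogeneous components, and let \<open>q\<close> be a power of the characteristic
  \<open>p\<close>. The Frobenius map is additive, so \<open>c x\<^sup>q = \<Sum>c\<^sub>e x\<^sub>d\<^sup>q\<close>, where \<open>c\<^sub>e x\<^sub>d\<^sup>q\<close> has degree
  \<open>e + q d\<close>. Only finitely many degrees \<open>e\<close> occur in \<open>c\<close>, so for large \<open>q\<close> their differences have
  coordinates smaller than \<open>q\<close>, and \<open>e + q d\<close> determines both \<open>e\<close> and \<open>d\<close>
  (\<open>eventually_bidegree_inj\<close>). The products \<open>c\<^sub>e x\<^sub>d\<^sup>q\<close> are then exactly the homogeneous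
  components of \<open>c x\<^sup>q\<close> (\<open>component_mult_power\<close>).

  If \<open>I\<close> is homogeneous, then so is \<open>I\<^bsup>(s,q)\<^esup>\<close>, since products, sums and Frobenius powers of
  homogeneous ideals are homogeneous (\<open>graded_sq_power\<close>). Hence \<open>c x\<^sup>q \<in> I\<^bsup>(s,q)\<^esup>\<close> for all
  \<open>q \<gg> 0\<close> forces \<open>c\<^sub>e x\<^sub>d\<^sup>q \<in> I\<^bsup>(s,q)\<^esup>\<close> for all \<open>e\<close>, \<open>d\<close> and all \<open>q \<gg> 0\<close>
  (\<open>eventually_products_mem\<close>). Summing over \<open>e\<close> gives \<open>c x\<^sub>d\<^sup>q \<in> I\<^bsup>(s,q)\<^esup>\<close>: the same
  multiplier \<open>c\<close> shows that every component of \<open>x\<close> lies in the weak closure, which is therefore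
  homogeneous. Summing over \<open>d\<close> gives \<open>c\<^sub>e x\<^sup>q \<in> I\<^bsup>(s,q)\<^esup>\<close>: in a domain any nonzero component of
  \<open>c\<close> is a homogeneous multiplier for \<open>x\<close>. Finally, in a noetherian ring the \<open>s\<close>-closure is a
  finite iterate of the weak closure, so its homogeneity follows by induction.\<close>

section \<open>The Frobenius map in prime characteristic\<close>

context cring
begin

lemma binomial_expansion:
  assumes [simp]: "x \<in> carrier R" "y \<in> carrier R"
  shows "(x \<oplus> y) [^] n = (\<Oplus>k\<in>{..n}. [(n choose k)] \<cdot> (x [^] k \<otimes> y [^] (n - k)))"
proof (induction n)
  case 0
  show ?case by simp
next
  case (Suc n)
  define t where "t m k = [(m choose k)] \<cdot> (x [^] k \<otimes> y [^] (m - k))" for m k :: nat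
  have t_closed [simp]: "t m k \<in> carrier R" for m k
    by (simp add: t_def)
  have t_beyond: "t n (Suc n) = \<zero>"
    by (simp add: t_def binomial_eq_0)
  \<comment> \<open>Binomial coefficients above the diagonal vanish, so this also covers \<open>k = n\<close>.\<close>
  have pascal: "t (Suc n) (Suc k) = x \<otimes> t n k \<oplus> y \<otimes> t n (Suc k)" if "k \<le> n" for k
  proof -
    have left: "x \<otimes> t n k = [(n choose k)] \<cdot> (x [^] Suc k \<otimes> y [^] (n - k))"
      by (simp add: t_def add_pow_rdistr m_ac)
    have right: "y \<otimes> t n (Suc k) = [(n choose Suc k)] \<cdot> (x [^] Suc k \<otimes> y [^] (n - k))"
    proof (cases "k = n")
      case True
      then show ?thesis by (simp add: t_def binomial_eq_0)
    next
      case False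
      with that have "n - k = Suc (n - Suc k)" by simp
      then show ?thesis by (simp add: t_def add_pow_rdistr m_ac)
    qed
    show ?thesis
      unfolding left right by (simp add: t_def add.nat_pow_mult)
  qed
  have bottom: "t (Suc n) 0 = y \<otimes> t n 0"
    by (simp add: t_def m_comm)
  have "(\<Oplus>k\<in>{..Suc n}. t (Suc n) k) = (\<Oplus>k\<in>{..n}. t (Suc n) (Suc k)) \<oplus> t (Suc n) 0"
    by (rule finsum_Suc2) simp
  also have "(\<Oplus>k\<in>{..n}. t (Suc n) (Suc k)) = (\<Oplus>k\<in>{..n}. x \<otimes> t n k \<oplus> y \<otimes> t n (Suc k))"
    by (rule finsum_cong') (auto simp: pascal)
  also have "\<dots> = x \<otimes> (\<Oplus>k\<in>{..n}. t n k) \<oplus> y \<otimes> (\<Oplus>k\<in>{..n}. t n (Suc k))"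
    by (simp add: finsum_addf finsum_rdistr Pi_def)
  also have "\<dots> \<oplus> t (Suc n) 0
      = x \<otimes> (\<Oplus>k\<in>{..n}. t n k) \<oplus> y \<otimes> ((\<Oplus>k\<in>{..n}. t n (Suc k)) \<oplus> t n 0)"
    by (simp add: bottom r_distr a_assoc)
  also have "(\<Oplus>k\<in>{..n}. t n (Suc k)) \<oplus> t n 0 = (\<Oplus>k\<in>{..Suc n}. t n k)"
    by (rule finsum_Suc2 [symmetric]) simp
  also have "\<dots> = (\<Oplus>k\<in>{..n}. t n k)"
    by (simp add: t_beyond)
  also have "x \<otimes> (\<Oplus>k\<in>{..n}. t n k) \<oplus> y \<otimes> (\<Oplus>k\<in>{..n}. t n k) = (x \<oplus> y) [^] Suc n"
    using Suc.IH by (simp add: t_def [symmetric] l_distr m_comm)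
  finally show ?case
    by (simp only: t_def)
qed

lemma char_multiple_zero:
  assumes "has_characteristic R p" "p dvd m" "x \<in> carrier R"
  shows "[m] \<cdot> x = \<zero>"
proof -
  have "[m] \<cdot> x = ([m] \<cdot> \<one>) \<otimes> x"
    using assms(3) by (simp add: add_pow_ldistr)
  moreover have "[m] \<cdot> \<one> = \<zero>"
    using assms(1,2) by (simp add: has_characteristic_def)
  ultimately show ?thesis
    using assms(3) by simp
qed

lemma frobenius_add:
  assumes char: "has_characteristic R p" and p: "Factorial_Ring.prime p"
    and [simp]: "x \<in> carrier R" "y \<in> carrier R"
  shows "(x \<oplus> y) [^] p = x [^] p \<oplus> y [^] p"
proof -
  define t where "t k = [(p choose k)] \<cdot> (x [^] k \<otimes> y [^] (p - k))" for k :: nat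
  have p_pos: "0 < p"
    using p by (simp add: prime_gt_0_nat)
  have "t k = \<zero>" if "0 < k" "k < p" for k
    unfolding t_def using that
    by (intro char_multiple_zero [OF char] dvd_choose_prime p) auto
  then have "(\<Oplus>k\<in>{..p}. t k) = (\<Oplus>k\<in>{0, p}. t k)"
    by (intro add.finprod_mono_neutral_cong_right) (auto simp: t_def)
  also have "\<dots> = x [^] p \<oplus> y [^] p"
    using p_pos by (simp add: t_def a_comm)
  finally show ?thesis
    by (simp add: binomial_expansion t_def)
qed

text \<open>The only consequence of the characteristic that the grading arguments need: they hold for
  any positive exponent whose power map is additive.\<close>

definition additive_power :: "nat \<Rightarrow> bool"
  where "additive_power q \<longleftrightarrow> 0 < q \<and>
    (\<forall>x\<in>carrier R. \<forall>y\<in>carrier R. (x \<oplus> y) [^] q = x [^] q \<oplus> y [^] q)"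

lemma additive_power_prime_power:
  assumes "has_characteristic R p" "Factorial_Ring.prime p"
  shows "additive_power (p ^ e)"
proof (induction e)
  case 0
  show ?case by (simp add: additive_power_def)
next
  case (Suc e)
  have pow: "z [^] (p ^ Suc e) = (z [^] (p ^ e)) [^] p" if "z \<in> carrier R" for z
    using that by (simp add: nat_pow_pow mult.commute)
  show ?case
    using Suc.IH assms unfolding additive_power_def
    by (auto simp: pow frobenius_add prime_gt_0_nat simp del: power_Suc)
qed

lemma additive_power_finsum:
  assumes "additive_power q" "finite F" "f \<in> F \<rightarrow> carrier R"
  shows "(\<Oplus>i\<in>F. f i) [^] q = (\<Oplus>i\<in>F. f i [^] q)"
  using assms(2,3)
proof (induction F)
  case empty
  show ?case
    using assms(1) by (simp add: additive_power_def nat_pow_zero)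
next
  case (insert i F)
  then have "f \<in> F \<rightarrow> carrier R" "f i \<in> carrier R" by auto
  with insert assms(1) show ?case
    by (simp add: additive_power_def Pi_def)
qed

end

section \<open>Homogeneous components\<close>

context Zn_graded_ring
begin

definition degrees :: "(nat \<Rightarrow> int) set"
  where "degrees = carrier (Zn n)"

definition component :: "'a \<Rightarrow> (nat \<Rightarrow> int) \<Rightarrow> 'a"
  where "component x = (THE f. f \<in> (\<Pi>\<^sub>E d\<in>degrees. A d) \<and>
    finite {d \<in> degrees. f d \<noteq> \<zero>} \<and> x = (\<Oplus>d\<in>{d \<in> degrees. f d \<noteq> \<zero>}. f d))"

definition support :: "'a \<Rightarrow> (nat \<Rightarrow> int) set"
  where "support x = {d \<in> degrees. component x d \<noteq> \<zero>}"

lemma piece_subgroup: "d \<in> degrees \<Longrightarrow> additive_subgroup (A d) R"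
  by (simp only: degrees_def component_subgroup)

lemma piece_closed: "d \<in> degrees \<Longrightarrow> x \<in> A d \<Longrightarrow> x \<in> carrier R"
  using additive_subgroup.a_Hcarr [OF piece_subgroup] .

lemma zero_in_piece: "d \<in> degrees \<Longrightarrow> \<zero> \<in> A d"
  using additive_subgroup.zero_closed [OF piece_subgroup] .

lemma component_works:
  assumes "x \<in> carrier R"
  shows "component x \<in> (\<Pi>\<^sub>E d\<in>degrees. A d) \<and> finite (support x) \<and>
    x = (\<Oplus>d\<in>support x. component x d)"
  using theI' [OF direct_sum [OF assms]]
  unfolding component_def [symmetric] support_def degrees_def [symmetric] .

lemma finite_support: "x \<in> carrier R \<Longrightarrow> finite (support x)"
  using component_works by blast

lemma component_sum: "x \<in> carrier R \<Longrightarrow> (\<Oplus>d\<in>support x. component x d) = x"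
  using component_works by metis

lemma component_in_piece:
  "x \<in> carrier R \<Longrightarrow> d \<in> degrees \<Longrightarrow> component x d \<in> A d"
  by (rule PiE_mem [OF conjunct1 [OF component_works]])

lemma component_closed [simp]:
  "x \<in> carrier R \<Longrightarrow> d \<in> degrees \<Longrightarrow> component x d \<in> carrier R"
  using component_in_piece piece_closed by blast

lemma support_degree: "d \<in> support x \<Longrightarrow> d \<in> degrees"
  by (simp add: support_def)

text \<open>The set \<open>D\<close> may be larger than the set where \<open>f\<close> is nonzero, so that components can be read
  off any decomposition without first discarding its zero terms.\<close>

lemma component_unique:
  assumes fin: "finite D" and D: "D \<subseteq> degrees"
    and f: "\<And>d. d \<in> degrees \<Longrightarrow> f d \<in> A d"
    and zero: "\<And>d. d \<in> degrees - D \<Longrightarrow> f d = \<zero>"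
    and x: "x = (\<Oplus>d\<in>D. f d)"
    and e: "e \<in> degrees"
  shows "component x e = f e"
proof -
  define g where "g = restrict f degrees"
  have fR: "f d \<in> carrier R" if "d \<in> degrees" for d
    using f piece_closed that by blast
  have xR: "x \<in> carrier R"
    using x D fR by (auto intro!: finsum_closed)
  have sub: "{d \<in> degrees. g d \<noteq> \<zero>} \<subseteq> D"
    using zero by (auto simp: g_def)
  have "(\<Oplus>d\<in>{d \<in> degrees. g d \<noteq> \<zero>}. g d) = (\<Oplus>d\<in>D. f d)"
    by (rule add.finprod_mono_neutral_cong_left [OF fin sub])
      (use D fR in \<open>auto simp: g_def\<close>)
  then have "g \<in> (\<Pi>\<^sub>E d\<in>degrees. A d) \<and> finite {d \<in> degrees. g d \<noteq> \<zero>} \<and>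
      x = (\<Oplus>d\<in>{d \<in> degrees. g d \<noteq> \<zero>}. g d)"
    using f x finite_subset [OF sub fin] by (auto simp: g_def)
  then have "component x = g"
    unfolding component_def using direct_sum [OF xR] unfolding degrees_def [symmetric]
    by (intro the1_equality)
  with e show ?thesis
    by (simp add: g_def)
qed

lemma component_homogeneous:
  assumes "d \<in> degrees" "x \<in> A d" "e \<in> degrees"
  shows "component x e = (if e = d then x else \<zero>)"
proof (rule component_unique [of "{d}"])
  show "x = (\<Oplus>e\<in>{d}. if e = d then x else \<zero>)"
    using assms piece_closed by simp
qed (use assms zero_in_piece in auto)

lemma component_zero: "d \<in> degrees \<Longrightarrow> component \<zero> d = \<zero>"
  using component_homogeneous [of d \<zero> d] zero_in_piece by simp

lemma component_add:
  assumes x: "x \<in> carrier R" and y: "y \<in> carrier R" and e: "e \<in> degrees"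
  shows "component (x \<oplus> y) e = component x e \<oplus> component y e"
proof (rule component_unique [OF _ _ _ _ _ e])
  let ?D = "support x \<union> support y"
  show fin: "finite ?D"
    using finite_support x y by simp
  show D: "?D \<subseteq> degrees"
    by (auto simp: support_def)
  show "component x d \<oplus> component y d \<in> A d" if "d \<in> degrees" for d
    using that x y component_in_piece additive_subgroup.a_closed [OF piece_subgroup] by blast
  show "component x d \<oplus> component y d = \<zero>" if "d \<in> degrees - ?D" for d
    using that by (auto simp: support_def)
  have widen: "(\<Oplus>d\<in>?D. component z d) = z" if "z \<in> carrier R" "support z \<subseteq> ?D" for z
  proof -
    have "(\<Oplus>d\<in>support z. component z d) = (\<Oplus>d\<in>?D. component z d)"
      by (rule add.finprod_mono_neutral_cong_left [OF fin that(2)])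
        (use D that in \<open>auto simp: support_def\<close>)
    then show ?thesis
      using component_sum that(1) by simp
  qed
  have "component z \<in> ?D \<rightarrow> carrier R" if "z \<in> carrier R" for z
    using that D by auto
  then show "x \<oplus> y = (\<Oplus>d\<in>?D. component x d \<oplus> component y d)"
    using x y by (simp add: finsum_addf widen)
qed

lemma component_finsum:
  assumes "finite F" "f \<in> F \<rightarrow> carrier R" "e \<in> degrees"
  shows "component (\<Oplus>i\<in>F. f i) e = (\<Oplus>i\<in>F. component (f i) e)"
  using assms(1,2)
proof (induction F)
  case empty
  show ?case using component_zero assms(3) by simp
next
  case (insert i F)
  then have "f \<in> F \<rightarrow> carrier R" "f i \<in> carrier R" by auto
  with insert assms(3) show ?case
    by (simp add: component_add Pi_def)
qed

text \<open>The operations of \<open>\<int>\<^sup>n\<close> are restricted to \<open>{..<n}\<close> because its elements are extensional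
  functions, undefined outside this set.\<close>

definition degree_add :: "(nat \<Rightarrow> int) \<Rightarrow> (nat \<Rightarrow> int) \<Rightarrow> nat \<Rightarrow> int"
  where "degree_add d e = (\<lambda>i\<in>{..<n}. d i + e i)"

definition degree_scale :: "nat \<Rightarrow> (nat \<Rightarrow> int) \<Rightarrow> nat \<Rightarrow> int"
  where "degree_scale q d = (\<lambda>i\<in>{..<n}. int q * d i)"

lemma degree_add_closed [simp]: "degree_add d e \<in> degrees"
  by (simp add: degrees_def degree_add_def)

lemma degree_scale_closed [simp]: "degree_scale q d \<in> degrees"
  by (simp add: degrees_def degree_scale_def)

lemma mult_in_piece:
  "\<lbrakk>d \<in> degrees; e \<in> degrees; x \<in> A d; y \<in> A e\<rbrakk> \<Longrightarrow> x \<otimes> y \<in> A (degree_add d e)"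
  using mult_degree by (simp add: degrees_def degree_add_def)

text \<open>The exponent \<open>0\<close> is left out because it would need that \<open>\<one>\<close> has degree \<open>0\<close>.\<close>

lemma power_in_piece:
  assumes d: "d \<in> degrees" and x: "x \<in> A d"
  shows "0 < q \<Longrightarrow> x [^] q \<in> A (degree_scale q d)"
proof (induction q rule: nat_induct_non_zero)
  case 1
  have "degree_scale 1 d = d"
    using d by (auto simp: degree_scale_def degrees_def PiE_def extensional_def)
  then show ?case
    using x piece_closed [OF d x] by simp
next
  case (Suc q)
  have "degree_scale (Suc q) d = degree_add (degree_scale q d) d"
    by (auto simp: degree_scale_def degree_add_def algebra_simps)
  with Suc.IH show ?case
    using mult_in_piece [OF degree_scale_closed d _ x] by simp
qed

lemma mult_components:
  assumes x: "x \<in> carrier R" and y: "y \<in> carrier R"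
  shows "x \<otimes> y = (\<Oplus>e\<in>support x. \<Oplus>d\<in>support y. component x e \<otimes> component y d)"
proof -
  have "x \<otimes> y = (\<Oplus>e\<in>support x. component x e) \<otimes> y"
    using component_sum x by simp
  also have "\<dots> = (\<Oplus>e\<in>support x. component x e \<otimes> y)"
    using x y finite_support support_degree by (intro finsum_ldistr) auto
  also have "\<dots> = (\<Oplus>e\<in>support x. component x e \<otimes> (\<Oplus>d\<in>support y. component y d))"
    using component_sum y by simp
  also have "\<dots> = (\<Oplus>e\<in>support x. \<Oplus>d\<in>support y. component x e \<otimes> component y d)"
  proof (rule finsum_cong' [OF refl])
    show "component x e \<otimes> (\<Oplus>d\<in>support y. component y d)
        = (\<Oplus>d\<in>support y. component x e \<otimes> component y d)" if "e \<in> support x" for e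
      using x y that finite_support support_degree by (intro finsum_rdistr) auto
  qed (use x y support_degree in \<open>auto intro!: finsum_closed\<close>)
  finally show ?thesis .
qed

lemma power_components:
  assumes "additive_power q" "x \<in> carrier R"
  shows "x [^] q = (\<Oplus>d\<in>support x. component x d [^] q)"
proof -
  have "x [^] q = (\<Oplus>d\<in>support x. component x d) [^] q"
    using component_sum assms(2) by simp
  also have "\<dots> = (\<Oplus>d\<in>support x. component x d [^] q)"
    using assms finite_support support_degree by (intro additive_power_finsum) auto
  finally show ?thesis .
qed

end

section \<open>Homogeneous ideals\<close>

lemma (in ring) ideal_finsum_closed:
  assumes "ideal J R" and "\<And>i. i \<in> F \<Longrightarrow> f i \<in> J"
  shows "(\<Oplus>i\<in>F. f i) \<in> J"
proof -
  interpret J: ideal J R by fact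
  show ?thesis
    using assms(2)
  proof (induction F rule: infinite_finite_induct)
    case (insert i F)
    then have "f \<in> F \<rightarrow> carrier R" "f i \<in> carrier R"
      using J.Icarr by auto
    with insert show ?case
      by (simp add: J.a_closed)
  qed (simp_all add: J.zero_closed)
qed

context Zn_graded_ring
begin

text \<open>Homogeneity in the form used in the arguments; it agrees with generation by homogeneous
  elements by \<open>homogeneous_ideal_iff_graded\<close> below.\<close>

definition graded_ideal :: "'a set \<Rightarrow> bool"
  where "graded_ideal J \<longleftrightarrow> ideal J R \<and> (\<forall>x\<in>J. \<forall>d\<in>degrees. component x d \<in> J)"

text \<open>A component of \<open>x \<otimes> y\<close> is a sum of some of the products \<open>x\<^sub>e \<otimes> y\<^sub>d\<close>, because each of these is
  homogeneous and so is its own only nonzero component.\<close>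

lemma component_mult_mem:
  assumes K: "ideal K R" and x: "x \<in> carrier R" and y: "y \<in> carrier R"
    and mem: "\<And>e d. \<lbrakk>e \<in> degrees; d \<in> degrees\<rbrakk> \<Longrightarrow> component x e \<otimes> component y d \<in> K"
    and g: "g \<in> degrees"
  shows "component (x \<otimes> y) g \<in> K"
proof -
  have "component (\<Oplus>d\<in>support y. component x e \<otimes> component y d) g \<in> K"
    if e: "e \<in> support x" for e
  proof -
    have "component (component x e \<otimes> component y d) g \<in> K" if "d \<in> support y" for d
      using e that mem x y g component_in_piece
        component_homogeneous [OF degree_add_closed mult_in_piece]
        additive_subgroup.zero_closed [OF ideal.axioms(1) [OF K]]
      by (auto simp: support_def)
    moreover have "component (\<Oplus>d\<in>support y. component x e \<otimes> component y d) g
        = (\<Oplus>d\<in>support y. component (component x e \<otimes> component y d) g)"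
      using e x y g finite_support support_degree by (intro component_finsum) auto
    ultimately show ?thesis
      by (metis (no_types, lifting) ideal_finsum_closed [OF K])
  qed
  moreover have "component (x \<otimes> y) g
      = (\<Oplus>e\<in>support x. component (\<Oplus>d\<in>support y. component x e \<otimes> component y d) g)"
    unfolding mult_components [OF x y]
    using x y g finite_support support_degree
    by (intro component_finsum) (auto intro!: finsum_closed)
  ultimately show ?thesis
    by (metis (no_types, lifting) ideal_finsum_closed [OF K])
qed

text \<open>As for products: since the power map is additive, a component of \<open>x [^] q\<close> is a sum of some of
  the homogeneous elements \<open>x\<^sub>d [^] q\<close>.\<close>

lemma component_power_mem:
  assumes q: "additive_power q" and K: "ideal K R" and x: "x \<in> carrier R"
    and mem: "\<And>d. d \<in> degrees \<Longrightarrow> component x d [^] q \<in> K"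
    and g: "g \<in> degrees"
  shows "component (x [^] q) g \<in> K"
proof -
  have "component (x [^] q) g = (\<Oplus>d\<in>support x. component (component x d [^] q) g)"
    unfolding power_components [OF q x]
    using x g finite_support support_degree by (intro component_finsum) auto
  moreover have "component (component x d [^] q) g \<in> K" if "d \<in> support x" for d
    using that mem x g q component_in_piece
      component_homogeneous [OF degree_scale_closed power_in_piece]
      additive_subgroup.zero_closed [OF ideal.axioms(1) [OF K]]
    by (auto simp: support_def additive_power_def)
  ultimately show ?thesis
    by (metis (no_types, lifting) ideal_finsum_closed [OF K])
qed

text \<open>It suffices to test generators: the elements all of whose components lie in the ideal \<open>Idl S\<close>
  form an ideal themselves, so this ideal contains \<open>Idl S\<close> as soon as it contains \<open>S\<close>.
  The generators need not be homogeneous, which is what Frobenius powers require.\<close>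

lemma graded_genideal:
  assumes S: "S \<subseteq> carrier R"
    and mem: "\<And>x d. \<lbrakk>x \<in> S; d \<in> degrees\<rbrakk> \<Longrightarrow> component x d \<in> Idl S"
  shows "graded_ideal (Idl S)"
proof -
  have IdlS: "ideal (Idl S) R"
    by (rule genideal_ideal [OF S])
  interpret K: ideal "Idl S" R by (rule IdlS)
  define H where "H = {x \<in> carrier R. \<forall>d\<in>degrees. component x d \<in> Idl S}"
  have mult: "a \<otimes> x \<in> H" if "x \<in> H" "a \<in> carrier R" for a x
    using that component_mult_mem [OF IdlS, of a x] K.I_l_closed
    by (auto simp: H_def)
  have "ideal H R"
  proof (rule idealI)
    show "ring R" by (rule ring_axioms)
    show "subgroup H (add_monoid R)"
    proof (rule add.subgroupI)
      show "H \<subseteq> carrier R" by (auto simp: H_def)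
      show "H \<noteq> {}"
        using component_zero K.zero_closed by (auto simp: H_def intro!: exI [of _ \<zero>])
      show "\<ominus> x \<in> H" if "x \<in> H" for x
      proof -
        have "\<ominus> x = (\<ominus> \<one>) \<otimes> x"
          using that by (simp add: H_def l_minus)
        then show ?thesis
          using mult that by simp
      qed
      show "x \<oplus> y \<in> H" if "x \<in> H" "y \<in> H" for x y
        using that by (auto simp: H_def component_add K.a_closed)
    qed
    show "a \<otimes> x \<in> H" if "x \<in> H" "a \<in> carrier R" for a x
      using mult that .
    show "x \<otimes> a \<in> H" if "x \<in> H" "a \<in> carrier R" for a x
      using mult [OF that] that m_comm by (simp add: H_def)
  qed
  then have "Idl S \<subseteq> H"
    by (rule genideal_minimal) (use S mem in \<open>auto simp: H_def\<close>)
  then show ?thesis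
    using IdlS by (auto simp: graded_ideal_def H_def)
qed

lemma homogeneous_ideal_iff_graded: "homogeneous_ideal n R A J \<longleftrightarrow> graded_ideal J"
proof
  assume "homogeneous_ideal n R A J"
  then obtain S where hom: "\<And>x. x \<in> S \<Longrightarrow> \<exists>d\<in>degrees. x \<in> A d" and J: "J = Idl S"
    unfolding homogeneous_ideal_def homogeneous_elem_def degrees_def by blast
  have S: "S \<subseteq> carrier R"
    using hom piece_closed by blast
  interpret K: ideal "Idl S" R by (rule genideal_ideal [OF S])
  show "graded_ideal J"
    unfolding J
  proof (rule graded_genideal [OF S])
    fix x d assume x: "x \<in> S" and "d \<in> degrees"
    with hom obtain e where "e \<in> degrees" "x \<in> A e" by blast
    then show "component x d \<in> Idl S"
      using component_homogeneous \<open>d \<in> degrees\<close> x genideal_self [OF S] K.zero_closed by auto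
  qed
next
  assume J: "graded_ideal J"
  then interpret J: ideal J R by (simp add: graded_ideal_def)
  let ?S = "{x \<in> J. homogeneous_elem n A x}"
  have S: "?S \<subseteq> carrier R"
    using J.Icarr by auto
  have "x \<in> Idl ?S" if x: "x \<in> J" for x
  proof -
    have "component x d \<in> Idl ?S" if d: "d \<in> degrees" for d
      using J x d component_in_piece [OF J.Icarr [OF x] d] genideal_self [OF S]
      by (auto simp: graded_ideal_def homogeneous_elem_def degrees_def)
    then have "(\<Oplus>d\<in>support x. component x d) \<in> Idl ?S"
      using support_degree by (intro ideal_finsum_closed genideal_ideal S) auto
    then show ?thesis
      using component_sum J.Icarr [OF x] by simp
  qed
  moreover have "Idl ?S \<subseteq> J"
    by (rule genideal_minimal [OF J.is_ideal]) auto
  ultimately have "J = Idl ?S" by blast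
  then show "homogeneous_ideal n R A J"
    unfolding homogeneous_ideal_def
    by (intro conjI exI [of _ ?S] J.is_ideal) simp_all
qed

lemma graded_ideal_prod:
  assumes "graded_ideal I" "graded_ideal J"
  shows "graded_ideal (ideal_prod R I J)"
proof -
  have I: "ideal I R" and J: "ideal J R"
    using assms by (auto simp: graded_ideal_def)
  have IJ: "ideal (ideal_prod R I J) R"
    by (rule ideal_prod_is_ideal [OF I J])
  have "component x d \<in> ideal_prod R I J" if "x \<in> ideal_prod R I J" "d \<in> degrees" for x d
    using that
  proof (induction x rule: ideal_prod.induct)
    case (prod i j)
    then show ?case
      using assms ideal.Icarr [OF I] ideal.Icarr [OF J]
      by (intro component_mult_mem [OF IJ]) (auto simp: graded_ideal_def intro: ideal_prod.prod)
  next
    case (sum x y)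
    then show ?case
      using ideal.Icarr [OF IJ] by (simp add: component_add ideal_prod.sum)
  qed
  with IJ show ?thesis
    by (simp add: graded_ideal_def)
qed

lemma graded_ideal_sum:
  assumes "graded_ideal I" "graded_ideal J"
  shows "graded_ideal (I <+>\<^bsub>R\<^esub> J)"
proof -
  have I: "ideal I R" and J: "ideal J R"
    using assms by (auto simp: graded_ideal_def)
  have "component (i \<oplus> j) d \<in> I <+>\<^bsub>R\<^esub> J" if "i \<in> I" "j \<in> J" "d \<in> degrees" for i j d
  proof -
    have "component i d \<in> I" "component j d \<in> J"
      using that assms by (auto simp: graded_ideal_def)
    then show ?thesis
      using that ideal.Icarr [OF I] ideal.Icarr [OF J]
      unfolding set_add_def' by (auto simp: component_add)
  qed
  then show ?thesis
    using add_ideals [OF I J] by (auto simp: graded_ideal_def set_add_def')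
qed

lemma graded_ideal_power:
  assumes I: "graded_ideal I"
  shows "graded_ideal (I [^]\<^bsub>ideals_set R\<^esub> (m::nat))"
proof (induction m)
  case 0
  then show ?case
    by (simp add: ideals_set_def graded_ideal_def oneideal)
next
  case (Suc m)
  with I show ?case
    by (simp add: graded_ideal_prod ideals_set_def)
qed

text \<open>The generators \<open>f [^] q\<close> are not homogeneous, but their components are sums of \<open>q\<close>-th powers of
  components of \<open>f\<close>, and these components lie in \<open>I\<close>.\<close>

lemma graded_frobenius_power:
  assumes I: "graded_ideal I" and q: "additive_power q"
  shows "graded_ideal (frobenius_power R I q)"
  unfolding frobenius_power_def
proof (rule graded_genideal)
  let ?S = "{f [^] q |f. f \<in> I}"
  have carr: "I \<subseteq> carrier R"
    using I ideal.Icarr by (auto simp: graded_ideal_def)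
  then show S: "?S \<subseteq> carrier R" by auto
  fix x d assume "x \<in> ?S" and d: "d \<in> degrees"
  then obtain f where f: "f \<in> I" and x: "x = f [^] q" by blast
  show "component x d \<in> Idl ?S"
    unfolding x
  proof (rule component_power_mem [OF q genideal_ideal [OF S] _ _ d])
    show "f \<in> carrier R" using f carr by blast
    show "component f e [^] q \<in> Idl ?S" if "e \<in> degrees" for e
      using I f that genideal_self [OF S] by (auto simp: graded_ideal_def)
  qed
qed

lemma graded_sq_power:
  "\<lbrakk>graded_ideal I; additive_power q\<rbrakk> \<Longrightarrow> graded_ideal (sq_power R s I q)"
  by (simp add: sq_power_def graded_ideal_sum graded_ideal_power graded_frobenius_power)

section \<open>Separation of degrees\<close>

text \<open>If \<open>e + q d = e' + q d'\<close>, then \<open>e - e'\<close> is divisible by \<open>q\<close> in every coordinate. As \<open>E\<close> is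
  finite, for large \<open>q\<close> this is possible only if \<open>e = e'\<close>. The bound on \<open>q\<close> depends only on \<open>E\<close>.\<close>

lemma eventually_bidegree_inj:
  assumes E: "finite E" "E \<subseteq> degrees" and D: "D \<subseteq> degrees"
  shows "\<forall>\<^sub>F q in sequentially. inj_on (\<lambda>(e, d). degree_add e (degree_scale q d)) (E \<times> D)"
proof -
  have "\<forall>\<^sub>F q in sequentially. \<forall>e\<in>E. \<forall>e'\<in>E. \<forall>i\<in>{..<n}. \<bar>e i - e' i\<bar> < int q"
  proof (intro eventually_ball_finite ballI E finite_lessThan)
    fix e e' :: "nat \<Rightarrow> int" and i
    show "\<forall>\<^sub>F q in sequentially. \<bar>e i - e' i\<bar> < int q"
      using eventually_gt_at_top [of "nat \<bar>e i - e' i\<bar>"] by eventually_elim linarith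
  qed
  then show ?thesis
  proof eventually_elim
    case (elim q)
    have "e = e' \<and> d = d'"
      if mem: "e \<in> E" "e' \<in> E" "d \<in> D" "d' \<in> D"
        and eq: "degree_add e (degree_scale q d) = degree_add e' (degree_scale q d')" for e e' d d'
    proof -
      have coord: "e i = e' i \<and> d i = d' i" if i: "i < n" for i
      proof -
        have "e i + int q * d i = e' i + int q * d' i"
          using fun_cong [OF eq, of i] i by (simp add: degree_add_def degree_scale_def)
        then have diff: "e i - e' i = int q * (d' i - d i)"
          by (simp add: algebra_simps)
        have "\<bar>e i - e' i\<bar> < int q"
          using elim mem i by auto
        then have "int q * \<bar>d' i - d i\<bar> < int q * 1"
          by (simp add: diff abs_mult)
        then have "d' i = d i"
          by (simp only: mult_less_cancel_left) auto
        with diff show ?thesis by simp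
      qed
      have ext: "f = g" if "f \<in> degrees" "g \<in> degrees" "\<And>i. i < n \<Longrightarrow> f i = g i" for f g
        using that unfolding degrees_def carrier_product_group
        by (intro PiE_ext) auto
      show ?thesis
        using mem E D coord by (auto intro!: ext)
    qed
    then show ?case
      by (auto simp: inj_on_def)
  qed
qed

text \<open>Of all products of a component of \<open>c\<close> with the \<open>q\<close>-th power of a component of \<open>x\<close>,
  injectivity leaves only one in degree \<open>e + q d\<close>.\<close>

lemma component_mult_power:
  assumes q: "additive_power q" and c: "c \<in> carrier R" and x: "x \<in> carrier R"
    and inj: "inj_on (\<lambda>(e, d). degree_add e (degree_scale q d)) (support c \<times> support x)"
    and e: "e \<in> support c" and d: "d \<in> support x"
  shows "component (c \<otimes> x [^] q) (degree_add e (degree_scale q d))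
    = component c e \<otimes> component x d [^] q"
proof -
  let ?g = "degree_add e (degree_scale q d)"
  let ?t = "\<lambda>e' d'. component c e' \<otimes> component x d' [^] q"
  have t_closed [simp]: "?t e' d' \<in> carrier R" if "e' \<in> support c" "d' \<in> support x" for e' d'
    using that c x support_degree by auto
  have fin: "finite (support c)" "finite (support x)"
    using finite_support c x by auto
  have t_comp: "component (?t e' d') ?g = (if e' = e \<and> d' = d then ?t e d else \<zero>)"
    if "e' \<in> support c" "d' \<in> support x" for e' d'
  proof -
    have "?t e' d' \<in> A (degree_add e' (degree_scale q d'))"
      using that q c x support_degree component_in_piece
      by (intro mult_in_piece power_in_piece) (auto simp: additive_power_def)
    then have "component (?t e' d') ?g
        = (if ?g = degree_add e' (degree_scale q d') then ?t e' d' else \<zero>)"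
      by (rule component_homogeneous [OF degree_add_closed _ degree_add_closed])
    moreover have "?g = degree_add e' (degree_scale q d') \<longleftrightarrow> e' = e \<and> d' = d"
      using inj_on_eq_iff [OF inj, of "(e, d)" "(e', d')"] that e d by auto
    ultimately show ?thesis by auto
  qed
  have cx: "component c e' \<otimes> x [^] q = (\<Oplus>d'\<in>support x. ?t e' d')" if "e' \<in> support c" for e'
    unfolding power_components [OF q x]
    using that c x support_degree fin by (intro finsum_rdistr) auto
  have row: "component (component c e' \<otimes> x [^] q) ?g = (if e' = e then ?t e d else \<zero>)"
    if e': "e' \<in> support c" for e'
  proof -
    have "component (component c e' \<otimes> x [^] q) ?g = (\<Oplus>d'\<in>support x. component (?t e' d') ?g)"
      unfolding cx [OF e'] using e' fin by (intro component_finsum) auto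
    also have "\<dots> = (\<Oplus>d'\<in>support x. if d = d' then (if e' = e then ?t e d' else \<zero>) else \<zero>)"
      by (rule finsum_cong') (use e e' t_comp in auto)
    also have "\<dots> = (if e' = e then ?t e d else \<zero>)"
      by (rule finsum_singleton) (use e d fin in auto)
    finally show ?thesis .
  qed
  have "c \<otimes> x [^] q = (\<Oplus>e'\<in>support c. component c e') \<otimes> x [^] q"
    using component_sum c by simp
  also have "\<dots> = (\<Oplus>e'\<in>support c. component c e' \<otimes> x [^] q)"
    using c x support_degree fin by (intro finsum_ldistr) auto
  finally have "component (c \<otimes> x [^] q) ?g = component (\<Oplus>e'\<in>support c. component c e' \<otimes> x [^] q) ?g"
    by simp
  also have "\<dots> = (\<Oplus>e'\<in>support c. component (component c e' \<otimes> x [^] q) ?g)"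
    using c x support_degree fin by (intro component_finsum) auto
  also have "\<dots> = (\<Oplus>e'\<in>support c. if e = e' then ?t e' d else \<zero>)"
    by (rule finsum_cong') (use d row in auto)
  also have "\<dots> = ?t e d"
    by (rule finsum_singleton) (use e d fin in auto)
  finally show ?thesis .
qed

lemma separated_products_mem:
  assumes q: "additive_power q" and c: "c \<in> carrier R" and x: "x \<in> carrier R"
    and inj: "inj_on (\<lambda>(e, d). degree_add e (degree_scale q d)) (support c \<times> support x)"
    and J: "graded_ideal J" and mem: "c \<otimes> x [^] q \<in> J"
    and e: "e \<in> degrees" and d: "d \<in> degrees"
  shows "component c e \<otimes> component x d [^] q \<in> J"
proof (cases "e \<in> support c \<and> d \<in> support x")
  case True
  then show ?thesis
    using component_mult_power [OF q c x inj] J mem degree_add_closed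
    unfolding graded_ideal_def by metis
next
  case False
  have "component c e = \<zero> \<or> component x d [^] q = \<zero>"
    using False e d q by (auto simp: support_def additive_power_def nat_pow_zero)
  then have "component c e \<otimes> component x d [^] q = \<zero>"
    using c x e d by auto
  moreover have "\<zero> \<in> J"
    using J by (auto simp: graded_ideal_def additive_subgroup.zero_closed ideal.axioms(1))
  ultimately show ?thesis by simp
qed

end

section \<open>The weak closure and its iterates\<close>

text \<open>The quantifier \<open>q \<gg> 0\<close> as a filter, so that finitely many such conditions can be combined.\<close>

definition large_powers :: "nat \<Rightarrow> nat filter"
  where "large_powers p = inf sequentially (principal {p ^ e |e. e \<ge> 1})"

lemma for_large_q_iff_eventually:
  "for_large_q p P \<longleftrightarrow> (\<forall>\<^sub>F q in large_powers p. P q)"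
  unfolding for_large_q_def large_powers_def eventually_inf_principal eventually_sequentially by blast

context cring
begin

lemma ideal_sq_power:
  assumes "ideal I R"
  shows "ideal (sq_power R s I q) R"
proof -
  have "ideal (I [^]\<^bsub>ideals_set R\<^esub> (m::nat)) R" for m
    by (induction m) (use assms in \<open>simp_all add: ideals_set_def oneideal ideal_prod_is_ideal\<close>)
  moreover have "ideal (frobenius_power R I q) R"
    unfolding frobenius_power_def using ideal.Icarr [OF assms] by (intro genideal_ideal) auto
  ultimately show ?thesis
    unfolding sq_power_def by (intro add_ideals)
qed

lemma power_mem_sq_power:
  assumes I: "ideal I R" and x: "x \<in> I"
  shows "x [^] q \<in> sq_power R s I q"
proof -
  have "x [^] q \<in> frobenius_power R I q"
    unfolding frobenius_power_def
    using ideal.Icarr [OF I] x by (intro subsetD [OF genideal_self]) auto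
  moreover have "\<zero> \<in> I [^]\<^bsub>ideals_set R\<^esub> (m::nat)" for m
    by (induction m)
      (use I in \<open>simp_all add: ideals_set_def additive_subgroup.zero_closed ideal.axioms(1)
        ideal_prod.prod [of \<zero> _ \<zero> _ R, simplified]\<close>)
  ultimately have "\<zero> \<oplus> x [^] q \<in> sq_power R s I q"
    unfolding sq_power_def set_add_def' by blast
  then show ?thesis
    using ideal.Icarr [OF I x] by simp
qed

lemma R_circ_one: "\<one> \<in> R_circ R"
proof -
  have "\<one> \<notin> P" if "primeideal P R" for P
    using that ideal.one_imp_carrier primeideal.I_notcarr primeideal.axioms(1) by metis
  then show ?thesis
    by (auto simp: R_circ_def minimal_prime_def)
qed

lemma R_circ_mult: "\<lbrakk>c \<in> R_circ R; d \<in> R_circ R\<rbrakk> \<Longrightarrow> c \<otimes> d \<in> R_circ R"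
  using primeideal.I_prime by (fastforce simp: R_circ_def minimal_prime_def)

lemma weak_s_closureE:
  assumes "x \<in> weak_s_closure R p s I"
  obtains c where "x \<in> carrier R" "c \<in> R_circ R" "c \<in> carrier R"
    "\<forall>\<^sub>F q in large_powers p. c \<otimes> x [^] q \<in> sq_power R s I q"
  using assms unfolding weak_s_closure_def for_large_q_iff_eventually R_circ_def by blast

lemma weak_s_closureI:
  assumes "x \<in> carrier R" "c \<in> R_circ R"
    "\<forall>\<^sub>F q in large_powers p. c \<otimes> x [^] q \<in> sq_power R s I q"
  shows "x \<in> weak_s_closure R p s I"
  using assms unfolding weak_s_closure_def for_large_q_iff_eventually by blast

lemma eventually_additive_power:
  assumes "has_characteristic R p" "Factorial_Ring.prime p"
  shows "\<forall>\<^sub>F q in large_powers p. additive_power q"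
  unfolding large_powers_def eventually_inf_principal
  using additive_power_prime_power [OF assms] by (intro always_eventually) auto

text \<open>The multiplier \<open>\<one>\<close> works.\<close>

lemma subset_weak_s_closure:
  assumes I: "ideal I R"
  shows "I \<subseteq> weak_s_closure R p s I"
proof
  fix x assume x: "x \<in> I"
  show "x \<in> weak_s_closure R p s I"
    using ideal.Icarr [OF I x] R_circ_one power_mem_sq_power [OF I x]
    by (intro weak_s_closureI) auto
qed

text \<open>If \<open>c\<close> and \<open>d\<close> are multipliers for \<open>x\<close> and \<open>y\<close>, then \<open>c \<otimes> d\<close> is one for \<open>x \<oplus> y\<close>, by additivity
  of the Frobenius map and because a prime ideal containing \<open>c \<otimes> d\<close> contains \<open>c\<close> or \<open>d\<close>.\<close>

lemma ideal_weak_s_closure: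
  assumes char: "has_characteristic R p" and p: "Factorial_Ring.prime p" and I: "ideal I R"
  shows "ideal (weak_s_closure R p s I) R" (is "ideal ?W R")
proof -
  note additive = eventually_additive_power [OF char p]
  have J: "ideal (sq_power R s I q) R" for q
    by (rule ideal_sq_power [OF I])
  have closed: "x \<in> carrier R" if "x \<in> ?W" for x
    using that by (simp add: weak_s_closure_def)
  have mult: "a \<otimes> x \<in> ?W" if "x \<in> ?W" and a: "a \<in> carrier R" for a x
    using \<open>x \<in> ?W\<close>
  proof (rule weak_s_closureE)
    fix c assume c: "x \<in> carrier R" "c \<in> R_circ R" "c \<in> carrier R"
      and ev: "\<forall>\<^sub>F q in large_powers p.
        c \<otimes> x [^] q \<in> sq_power R s I q"
    show ?thesis
    proof (rule weak_s_closureI)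
      show "\<forall>\<^sub>F q in large_powers p.
          c \<otimes> (a \<otimes> x) [^] q \<in> sq_power R s I q"
        using ev
      proof eventually_elim
        case (elim q)
        have "c \<otimes> (a \<otimes> x) [^] q = a [^] q \<otimes> (c \<otimes> x [^] q)"
          using a c by (simp add: nat_pow_distrib m_lcomm)
        with elim a show ?case
          by (simp add: ideal.I_l_closed [OF J])
      qed
    qed (use a c in auto)
  qed
  have add: "x \<oplus> y \<in> ?W" if "x \<in> ?W" "y \<in> ?W" for x y
  proof -
    obtain c where c: "x \<in> carrier R" "c \<in> R_circ R" "c \<in> carrier R"
      and evx: "\<forall>\<^sub>F q in large_powers p.
        c \<otimes> x [^] q \<in> sq_power R s I q"
      using weak_s_closureE [OF \<open>x \<in> ?W\<close>] by blast
    obtain d where d: "y \<in> carrier R" "d \<in> R_circ R" "d \<in> carrier R"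
      and evy: "\<forall>\<^sub>F q in large_powers p.
        d \<otimes> y [^] q \<in> sq_power R s I q"
      using weak_s_closureE [OF \<open>y \<in> ?W\<close>] by blast
    show ?thesis
    proof (rule weak_s_closureI)
      show "\<forall>\<^sub>F q in large_powers p.
          (c \<otimes> d) \<otimes> (x \<oplus> y) [^] q \<in> sq_power R s I q"
        using evx evy additive
      proof eventually_elim
        case (elim q)
        have "(x \<oplus> y) [^] q = x [^] q \<oplus> y [^] q"
          using elim(3) c d by (simp add: additive_power_def)
        then have "(c \<otimes> d) \<otimes> (x \<oplus> y) [^] q = d \<otimes> (c \<otimes> x [^] q) \<oplus> c \<otimes> (d \<otimes> y [^] q)"
          using c d by (simp add: r_distr m_ac)
        with elim c d show ?case
          by (simp add: ideal.I_l_closed [OF J] additive_subgroup.a_closed ideal.axioms(1) [OF J])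
      qed
    qed (use c d R_circ_mult in auto)
  qed
  show ?thesis
  proof (rule idealI [OF ring_axioms])
    show "subgroup ?W (add_monoid R)"
    proof (rule add.subgroupI)
      show "?W \<subseteq> carrier R" using closed by blast
      show "?W \<noteq> {}"
        using subset_weak_s_closure [OF I] additive_subgroup.zero_closed [OF ideal.axioms(1) [OF I]]
        by blast
      show "\<ominus> x \<in> ?W" if "x \<in> ?W" for x
      proof -
        have "\<ominus> x = (\<ominus> \<one>) \<otimes> x"
          using closed [OF that] by (simp add: l_minus)
        then show ?thesis
          using mult that by simp
      qed
    qed (rule add)
    show "a \<otimes> x \<in> ?W" if "x \<in> ?W" "a \<in> carrier R" for a x
      using mult that .
    show "x \<otimes> a \<in> ?W" if "x \<in> ?W" "a \<in> carrier R" for a x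
      using mult [OF that] that closed m_comm by simp
  qed
qed

text \<open>The iterates form an increasing chain of ideals, which stabilizes in a noetherian ring; the
  definite description in the \<open>s\<close>-closure therefore denotes the stable value.\<close>

lemma s_closure_eq_iterate:
  assumes noeth: "noetherian_ring R"
    and char: "has_characteristic R p" and p: "Factorial_Ring.prime p" and I: "ideal I R"
  obtains N where "s_closure R p s I = (weak_s_closure R p s ^^ N) I"
proof -
  interpret noetherian_ring R by fact
  define W where "W k = (weak_s_closure R p s ^^ k) I" for k
  have ideal_W: "ideal (W k) R" for k
    by (induction k) (use I char p in \<open>simp_all add: W_def ideal_weak_s_closure\<close>)
  have "W k \<subseteq> W (Suc k)" for k
    using subset_weak_s_closure [OF ideal_W] by (simp add: W_def)
  then have mono: "W k \<subseteq> W l" if "k \<le> l" for k l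
    using lift_Suc_mono_le that by metis
  have "\<Union>(range W) \<in> range W"
  proof (rule ideal_chain_is_trivial)
    show "subset.chain {I. ideal I R} (range W)"
    proof -
      have "W k \<subseteq> W l \<or> W l \<subseteq> W k" for k l
        using mono nat_le_linear [of k l] by blast
      then show ?thesis
        unfolding subset_chain_def using ideal_W by auto
    qed
  qed simp
  then obtain N where N: "\<Union>(range W) = W N" by blast
  have stable: "W k = W N" if "k \<ge> N" for k
    using N mono [OF that] by blast
  have "s_closure R p s I = W N"
    unfolding s_closure_def W_def [symmetric]
  proof (rule the_equality)
    show "\<exists>M. \<forall>k\<ge>M. W k = W N"
      using stable by blast
    show "J = W N" if J: "\<exists>M. \<forall>k\<ge>M. W k = J" for J
    proof -
      obtain M where "\<forall>k\<ge>M. W k = J" using J by blast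
      then show ?thesis
        using stable [of "max M N"] by simp
    qed
  qed
  with that show thesis
    by (simp add: W_def)
qed

end

text \<open>The zero ideal is the only minimal prime of a domain.\<close>

lemma (in domain) R_circ_nonzero: "R_circ R = carrier R - {\<zero>}"
proof -
  have zero_mem: "\<zero> \<in> P" if "primeideal P R" for P
    using that by (simp add: additive_subgroup.zero_closed ideal.axioms(1) primeideal.axioms(1))
  then have "minimal_prime R P \<longleftrightarrow> P = {\<zero>}" for P
    unfolding minimal_prime_def using zeroprimeideal by blast
  then show ?thesis
    by (auto simp: R_circ_def)
qed

section \<open>Homogeneity of the closures\<close>

context Zn_graded_ring
begin

lemma eventually_products_mem:
  assumes char: "has_characteristic R p" and p: "Factorial_Ring.prime p"
    and I: "graded_ideal I" and c: "c \<in> carrier R" and x: "x \<in> carrier R"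
    and ev: "\<forall>\<^sub>F q in large_powers p.
      c \<otimes> x [^] q \<in> sq_power R s I q"
  shows "\<forall>\<^sub>F q in large_powers p.
    \<forall>e\<in>degrees. \<forall>d\<in>degrees. component c e \<otimes> component x d [^] q \<in> sq_power R s I q"
proof -
  have "\<forall>\<^sub>F q in large_powers p.
      inj_on (\<lambda>(e, d). degree_add e (degree_scale q d)) (support c \<times> support x)"
    using eventually_bidegree_inj [of "support c" "support x"] finite_support c support_degree
    unfolding large_powers_def by (intro filter_leD [OF inf_le1]) blast
  with ev eventually_additive_power [OF char p] show ?thesis
  proof eventually_elim
    case (elim q)
    then show ?case
      using separated_products_mem [OF elim(2) c x elim(3) graded_sq_power [OF I elim(2)] elim(1)]
      by blast
  qed
qed

text \<open>A multiplier \<open>c\<close> for \<open>x\<close> is also one for each component of \<open>x\<close>: the products \<open>c\<^sub>e \<otimes> x\<^sub>d [^] q\<close> lie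
  in the ideal, and their sum over \<open>e\<close> is \<open>c \<otimes> x\<^sub>d [^] q\<close>.\<close>

lemma graded_weak_s_closure:
  assumes char: "has_characteristic R p" and p: "Factorial_Ring.prime p" and I: "graded_ideal I"
  shows "graded_ideal (weak_s_closure R p s I)"
proof -
  have idI: "ideal I R"
    using I by (simp add: graded_ideal_def)
  have "component x d \<in> weak_s_closure R p s I"
    if x: "x \<in> weak_s_closure R p s I" and d: "d \<in> degrees" for x d
    using x
  proof (rule weak_s_closureE)
    fix c assume c: "x \<in> carrier R" "c \<in> R_circ R" "c \<in> carrier R"
      and ev: "\<forall>\<^sub>F q in large_powers p.
        c \<otimes> x [^] q \<in> sq_power R s I q"
    show ?thesis
    proof (rule weak_s_closureI)
      show "\<forall>\<^sub>F q in large_powers p.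
          c \<otimes> component x d [^] q \<in> sq_power R s I q"
        using eventually_products_mem [OF char p I c(3) c(1) ev]
      proof eventually_elim
        case (elim q)
        have "(\<Oplus>e\<in>support c. component c e \<otimes> component x d [^] q) \<in> sq_power R s I q"
          using elim d support_degree by (intro ideal_finsum_closed ideal_sq_power idI) auto
        moreover have "(\<Oplus>e\<in>support c. component c e \<otimes> component x d [^] q)
            = c \<otimes> component x d [^] q"
          using finsum_ldistr [of "support c" "component x d [^] q" "component c"]
            component_sum c d finite_support support_degree by (auto simp: Pi_def)
        ultimately show ?case by simp
      qed
    qed (use c d in auto)
  qed
  then show ?thesis
    using ideal_weak_s_closure [OF char p idI] by (simp add: graded_ideal_def)
qed

lemma graded_s_closure:
  assumes "noetherian_ring R" and char: "has_characteristic R p"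
    and p: "Factorial_Ring.prime p" and I: "graded_ideal I"
  shows "graded_ideal (s_closure R p s I)"
proof -
  have "graded_ideal ((weak_s_closure R p s ^^ k) I)" for k
    by (induction k) (use I graded_weak_s_closure [OF char p] in simp_all)
  moreover obtain N where "s_closure R p s I = (weak_s_closure R p s ^^ N) I"
    using s_closure_eq_iterate [OF assms(1) char p] I by (auto simp: graded_ideal_def)
  ultimately show ?thesis by simp
qed

text \<open>Here the products \<open>c\<^sub>e \<otimes> x\<^sub>d [^] q\<close> are summed over \<open>d\<close> instead, for one \<open>e\<close> with \<open>c\<^sub>e \<noteq> \<zero>\<close>.\<close>

lemma homogeneous_multiplier:
  assumes dom: "domain R" and char: "has_characteristic R p" and p: "Factorial_Ring.prime p"
    and I: "graded_ideal I" and x: "x \<in> weak_s_closure R p s I"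
  shows "\<exists>c\<in>carrier R. c \<noteq> \<zero> \<and> homogeneous_elem n A c \<and>
    for_large_q p (\<lambda>q. c \<otimes> x [^] q \<in> sq_power R s I q)"
  using x
proof (rule weak_s_closureE)
  fix c assume c: "x \<in> carrier R" "c \<in> R_circ R" "c \<in> carrier R"
    and ev: "\<forall>\<^sub>F q in large_powers p.
      c \<otimes> x [^] q \<in> sq_power R s I q"
  have idI: "ideal I R"
    using I by (simp add: graded_ideal_def)
  have "c \<noteq> \<zero>"
    using c(2) domain.R_circ_nonzero [OF dom] by simp
  then have "support c \<noteq> {}"
    using component_sum [OF c(3)] by auto
  then obtain e where e: "e \<in> degrees" "component c e \<noteq> \<zero>"
    by (auto simp: support_def)
  have "\<forall>\<^sub>F q in large_powers p.
      component c e \<otimes> x [^] q \<in> sq_power R s I q"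
    using eventually_products_mem [OF char p I c(3) c(1) ev] eventually_additive_power [OF char p]
  proof eventually_elim
    case (elim q)
    have "(\<Oplus>d\<in>support x. component c e \<otimes> component x d [^] q) \<in> sq_power R s I q"
      using elim e support_degree by (intro ideal_finsum_closed ideal_sq_power idI) auto
    moreover have "(\<Oplus>d\<in>support x. component c e \<otimes> component x d [^] q)
        = component c e \<otimes> x [^] q"
      unfolding power_components [OF elim(2) c(1)]
      using c e finite_support support_degree by (intro finsum_rdistr [symmetric]) auto
    ultimately show ?case by simp
  qed
  with e c component_in_piece [OF c(3) e(1)] show ?thesis
    unfolding homogeneous_elem_def for_large_q_iff_eventually degrees_def [symmetric]
    by (intro bexI [of _ "component c e"]) auto
qed

end

theorem theorem3p1:
  fixes R :: "('a, 'b) ring_scheme" (structure)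
    and A :: "(nat \<Rightarrow> int) \<Rightarrow> 'a set"
    and n p :: nat
    and s :: real
    and I :: "'a set"
  assumes "Zn_graded_ring n R A"
    and "noetherian_ring R"
    and "Factorial_Ring.prime p"
    and "has_characteristic R p"
    and "homogeneous_ideal n R A I"
    and "s \<ge> 1"
  shows "homogeneous_ideal n R A (weak_s_closure R p s I)
    \<and> homogeneous_ideal n R A (s_closure R p s I)
    \<and> (domain R \<longrightarrow>
        (\<forall>x\<in>weak_s_closure R p s I.
           \<exists>c\<in>carrier R. c \<noteq> \<zero> \<and> homogeneous_elem n A c \<and>
             for_large_q p (\<lambda>q. c \<otimes> (x [^] q) \<in> sq_power R s I q)))"
proof -
  interpret Zn_graded_ring n R A by fact
  have I: "graded_ideal I"
    using assms(5) by (simp add: homogeneous_ideal_iff_graded)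
  show ?thesis
    unfolding homogeneous_ideal_iff_graded
    using graded_weak_s_closure [OF assms(4,3) I] graded_s_closure [OF assms(2,4,3) I]
      homogeneous_multiplier [OF _ assms(4,3) I]
    by blast
qed

end
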